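(* Let $G$ and $H$ be finite simple graphs. If the Cartesian product $G \,\Box\, H$ is connected and well-dominated, then $G$ or $H$ is a complete graph.
   Context: All graphs are finite and simple (undirected, no loops, no multiple edges), with nonempty vertex set. For a graph $X$ and $S \subseteq V(X)$, the closed neighborhood $N[S]$ is $S$ together with all vertices adjacent to some vertex of $S$. A dominating set of $X$ is a set $S \subseteq V(X)$ with $N[S] = V(X)$; it is minimal if $S - \{x\}$ does not dominate $X$ for every $x \in S$. The domination number $\gamma(X)$ is the cardinality of a smallest dominating set of $X$. The graph $X$ is well-dominated if all of its minimal dominating sets have the same cardinality, namely $\gamma(X)$. The Cartesian product $X \,\Box\, Y$ has vertex set $V(X) \times V(Y)$, and two vertices $(x_1,y_1)$ and $(x_2,y_2)$ are adjacent if they are equal in one coordinate and adjacent in the other coordinate. The one-vertex graph $K_1$ counts as a complete graph. *)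

theory Defs
  imports "Graph_Theory.Graph_Theory"
begin

text \<open>
  Finite simple graphs are the pair digraphs satisfying \<^locale>\<open>pair_graph\<close>: finite, loop-free and
  symmetric, an undirected edge being the two arcs \<open>(u, v)\<close> and \<open>(v, u)\<close>. The library constant
  \<^const>\<open>dominates\<close> denotes adjacency and has nothing to do with dominating sets.
\<close>

definition closed_neighborhood :: "('a, 'b) pre_digraph \<Rightarrow> 'a set \<Rightarrow> 'a set" where
  "closed_neighborhood X S = S \<union> {v \<in> verts X. \<exists>u \<in> S. u \<rightarrow>\<^bsub>X\<^esub> v}"

definition dominating_set :: "('a, 'b) pre_digraph \<Rightarrow> 'a set \<Rightarrow> bool" where
  "dominating_set X S \<longleftrightarrow> S \<subseteq> verts X \<and> closed_neighborhood X S = verts X"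

definition minimal_dominating_set :: "('a, 'b) pre_digraph \<Rightarrow> 'a set \<Rightarrow> bool" where
  "minimal_dominating_set X S \<longleftrightarrow>
     dominating_set X S \<and> (\<forall>x \<in> S. \<not> dominating_set X (S - {x}))"

definition domination_number :: "('a, 'b) pre_digraph \<Rightarrow> nat" where
  "domination_number X = (LEAST k. \<exists>S. dominating_set X S \<and> card S = k)"

definition well_dominated :: "('a, 'b) pre_digraph \<Rightarrow> bool" where
  "well_dominated X \<longleftrightarrow> (\<forall>S. minimal_dominating_set X S \<longrightarrow> card S = domination_number X)"

definition complete_graph :: "('a, 'b) pre_digraph \<Rightarrow> bool" where
  "complete_graph X \<longleftrightarrow> (\<exists>n. complete_digraph n X)"

definition cartesian_product ::
  "'a pair_pre_digraph \<Rightarrow> 'b pair_pre_digraph \<Rightarrow> ('a \<times> 'b) pair_pre_digraph" where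
  "cartesian_product X Y =
     \<lparr> pverts = pverts X \<times> pverts Y,
       parcs = {((x1, y1), (x2, y2)) | x1 y1 x2 y2.
         x1 = x2 \<and> x1 \<in> pverts X \<and> (y1, y2) \<in> parcs Y \<or>
         y1 = y2 \<and> y1 \<in> pverts Y \<and> (x1, x2) \<in> parcs X} \<rparr>"

lemma pair_graph_cartesian_product:
  assumes "pair_graph X" and "pair_graph Y"
  shows "pair_graph (cartesian_product X Y)"
proof -
  interpret X: pair_graph X by fact
  interpret Y: pair_graph Y by fact
  let ?P = "cartesian_product X Y"
  have sub: "parcs ?P \<subseteq> pverts ?P \<times> pverts ?P"
    using X.wellformed' Y.wellformed' by (auto simp: cartesian_product_def)
  have fin: "finite (pverts ?P)"
    using X.pair_finite_verts Y.pair_finite_verts by (simp add: cartesian_product_def)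
  show ?thesis
  proof
    show "fst e \<in> pverts ?P" "snd e \<in> pverts ?P" if "e \<in> parcs ?P" for e
      using that sub by auto
    show "finite (pverts ?P)" by (fact fin)
    show "finite (parcs ?P)" using sub fin by (meson finite_SigmaI finite_subset)
    show "fst e \<noteq> snd e" if "e \<in> parcs ?P" for e
      using that X.no_loops' Y.no_loops' by (auto simp: cartesian_product_def)
    show "symmetric (with_proj ?P)"
      using X.arcs_symmetric Y.arcs_symmetric
      by (auto simp: symmetric_def sym_def cartesian_product_def)
  qed
qed

end

theory Submission
  imports Defs
begin

text \<open>
  Suppose that neither factor is complete, and let \<open>k\<close> be the largest size of a closed neighborhood in
  the two factors, say \<open>k = card N[v]\<close> with \<open>v\<close> in \<open>G\<close>. Two estimates of the common size of the
  minimal dominating sets of the product contradict each other.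

  Upper bound: let \<open>E\<close> be a dominating set of \<open>H\<close> in which every vertex has an external private
  neighbor. Then \<open>V(G) \<times> E\<close> is a minimal dominating set of the product, and comparing it with the
  dominating set \<open>{v} \<times> V(H) \<union> (V(G) - N[v]) \<times> E\<close> gives \<open>k * card E \<le> card V(H)\<close>, so the common
  size is at most \<open>card V(G) * card V(H) / k\<close>.

  Lower bound: each factor, having an induced path on three vertices, has a maximal independent set
  of density above \<open>1 / k\<close>; its complement is greedily colored with \<open>k - 1\<close> colors. Combining the
  color classes of the two factors as in a Latin square yields an independent set of the product of
  density above \<open>1 / k\<close>, and it extends to a minimal dominating set.
\<close>

section \<open>Dominating sets and independent sets\<close>

lemma (in pair_graph) dominating_set_iff:
  "dominating_set G S \<longleftrightarrow>
     S \<subseteq> pverts G \<and> (\<forall>v \<in> pverts G. v \<in> S \<or> (\<exists>u \<in> S. (u, v) \<in> parcs G))"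
  by (auto simp: dominating_set_def closed_neighborhood_def)

lemma (in pair_graph) closed_neighborhood_singleton:
  assumes "v \<in> pverts G"
  shows "closed_neighborhood G {v} = insert v {u. (v, u) \<in> parcs G}"
  using wellformed' by (auto simp: closed_neighborhood_def)

lemma (in pair_graph) pverts_dominating:
  "dominating_set G (pverts G)"
  by (auto simp: dominating_set_iff)

definition independent_vertices :: "('a, 'b) pre_digraph \<Rightarrow> 'a set \<Rightarrow> bool" where
  "independent_vertices X S \<longleftrightarrow> S \<subseteq> verts X \<and> (\<forall>u \<in> S. \<forall>v \<in> S. \<not> u \<rightarrow>\<^bsub>X\<^esub> v)"

text \<open>An inclusion-maximal independent set dominates, since an undominated vertex could be
  added; it does so minimally, since each of its vertices is dominated within it only by
  itself.\<close>

lemma (in pair_graph) independent_extends_to_minimal_dominating: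
  assumes "independent_vertices G S"
  obtains T where "S \<subseteq> T" "independent_vertices G T" "minimal_dominating_set G T"
proof -
  let ?F = "{T. S \<subseteq> T \<and> independent_vertices G T}"
  have fin: "finite ?F"
    by (rule finite_subset[of _ "Pow (pverts G)"])
      (auto simp: independent_vertices_def pair_finite_verts)
  have "S \<in> ?F" using assms by simp
  from finite_has_maximal2[OF fin this] obtain T
    where T: "T \<in> ?F" and max: "\<forall>T' \<in> ?F. T \<le> T' \<longrightarrow> T = T'"
    by (elim bexE conjE)
  have indep: "\<And>u v. u \<in> T \<Longrightarrow> v \<in> T \<Longrightarrow> (u, v) \<notin> parcs G" and sub: "T \<subseteq> pverts G"
    using T by (auto simp: independent_vertices_def)
  have "v \<in> T \<or> (\<exists>u \<in> T. (u, v) \<in> parcs G)" if v: "v \<in> pverts G" for v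
  proof (rule ccontr)
    assume neg: "\<not> ?thesis"
    have "insert v T \<in> ?F"
      using T v neg arcs_symmetric no_loops'
      by (auto simp: independent_vertices_def)
    from max[rule_format, OF this] have "T = insert v T" by blast
    then show False using neg by blast
  qed
  then have dom: "dominating_set G T"
    using sub by (auto simp: dominating_set_iff)
  have "\<not> dominating_set G (T - {x})" if "x \<in> T" for x
    using that indep sub by (auto simp: dominating_set_iff)
  with dom T that show thesis
    by (auto simp: minimal_dominating_set_def)
qed

lemma minimal_dominating_card_le:
  assumes "well_dominated X" "minimal_dominating_set X M" "dominating_set X D"
  shows "card M \<le> card D"
proof -
  have "card M = domination_number X"
    using assms(1,2) by (simp add: well_dominated_def)
  also have "\<dots> \<le> card D"
    unfolding domination_number_def by (rule Least_le) (use assms(3) in blast)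
  finally show ?thesis .
qed

lemma (in pair_graph) independent_card_le:
  assumes "well_dominated G" "independent_vertices G S" "dominating_set G D"
  shows "card S \<le> card D"
proof -
  obtain T where T: "S \<subseteq> T" "independent_vertices G T" "minimal_dominating_set G T"
    using independent_extends_to_minimal_dominating assms(2) by blast
  have "finite T"
    using T(2) by (auto simp: independent_vertices_def intro: finite_subset[OF _ pair_finite_verts])
  then have "card S \<le> card T" using T(1) by (rule card_mono)
  also have "\<dots> \<le> card D" using minimal_dominating_card_le assms T by blast
  finally show ?thesis .
qed

section \<open>Connectedness of the factors\<close>

lemma (in pair_graph) connected_iff_reachable:
  "connected G \<longleftrightarrow> pverts G \<noteq> {} \<and> (\<forall>u \<in> pverts G. \<forall>v \<in> pverts G. u \<rightarrow>\<^sup>*\<^bsub>G\<^esub> v)"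
  by (simp add: connected_def strongly_connected_def reachable_mk_symmetric_eq[OF pair_sym_arcs])

text \<open>Without such a path, being equal or adjacent is transitive, so reachability collapses to
  it and connectedness forces completeness.\<close>

lemma (in pair_graph) connected_noncomplete_induced_path:
  assumes "connected G" "\<not> complete_graph G"
  obtains a d c where "(a, d) \<in> parcs G" "(d, c) \<in> parcs G" "(a, c) \<notin> parcs G" "a \<noteq> c"
proof (rule ccontr)
  assume "\<not> thesis"
  with that have trans: "\<And>a d c. (a, d) \<in> parcs G \<Longrightarrow> (d, c) \<in> parcs G \<Longrightarrow> a \<noteq> c \<Longrightarrow> (a, c) \<in> parcs G"
    by blast
  have adj: "u = v \<or> (u, v) \<in> parcs G" if "u \<rightarrow>\<^sup>*\<^bsub>G\<^esub> v" for u v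
    using that
  proof (induction rule: converse_reachable_induct)
    case base
    then show ?case by simp
  next
    case (step x y)
    then show ?case using trans by auto
  qed
  have "parcs G = {(u, v). (u, v) \<in> pverts G \<times> pverts G \<and> u \<noteq> v}"
  proof (intro equalityI subrelI)
    fix u v assume "(u, v) \<in> {(u, v). (u, v) \<in> pverts G \<times> pverts G \<and> u \<noteq> v}"
    then show "(u, v) \<in> parcs G"
      using adj[of u v] assms(1) by (simp add: connected_iff_reachable)
  qed (use wellformed' no_loops' in blast)
  then have "complete_digraph (card (pverts G)) G"
    by (simp add: complete_digraph_pair_def pair_finite_verts)
  with assms(2) show False by (auto simp: complete_graph_def)
qed

lemma (in pair_graph) connected_has_neighbor:
  assumes "connected G" "v \<in> pverts G" "w \<in> pverts G" "v \<noteq> w"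
  obtains u where "(v, u) \<in> parcs G"
proof -
  have "v \<rightarrow>\<^sup>*\<^bsub>G\<^esub> w" using assms by (simp add: connected_iff_reachable)
  then show thesis
    by (cases rule: converse_reachable_cases) (use assms that in auto)
qed

lemma pverts_cartesian_product [simp]:
  "pverts (cartesian_product X Y) = pverts X \<times> pverts Y"
  by (simp add: cartesian_product_def)

lemma parcs_cartesian_product:
  "((x1, y1), (x2, y2)) \<in> parcs (cartesian_product X Y) \<longleftrightarrow>
     x1 = x2 \<and> x1 \<in> pverts X \<and> (y1, y2) \<in> parcs Y \<or>
     y1 = y2 \<and> y1 \<in> pverts Y \<and> (x1, x2) \<in> parcs X"
  by (simp add: cartesian_product_def)

text \<open>Walks project to the factors: an arc of the product moves one coordinate along an arc
  and fixes the other.\<close>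

lemma connected_cartesian_product:
  assumes "pair_graph X" "pair_graph Y" "connected (cartesian_product X Y)"
  shows "connected X" and "connected Y"
proof -
  interpret X: pair_graph X by fact
  interpret Y: pair_graph Y by fact
  interpret P: pair_graph "cartesian_product X Y"
    by (rule pair_graph_cartesian_product) fact+
  have reach: "fst p \<rightarrow>\<^sup>*\<^bsub>X\<^esub> fst q \<and> snd p \<rightarrow>\<^sup>*\<^bsub>Y\<^esub> snd q"
    if "p \<rightarrow>\<^sup>*\<^bsub>cartesian_product X Y\<^esub> q" for p q
    using that
  proof (induction rule: P.converse_reachable_induct)
    case base
    then show ?case by (auto simp: cartesian_product_def)
  next
    case (step p r)
    then show ?case
      by (cases p; cases r)
        (auto simp: parcs_cartesian_product intro: X.adj_reachable_trans Y.adj_reachable_trans)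
  qed
  have ne: "pverts X \<noteq> {}" "pverts Y \<noteq> {}"
    and all: "\<And>p q. p \<in> pverts X \<times> pverts Y \<Longrightarrow> q \<in> pverts X \<times> pverts Y \<Longrightarrow>
      p \<rightarrow>\<^sup>*\<^bsub>cartesian_product X Y\<^esub> q"
    using assms(3) by (auto simp: P.connected_iff_reachable)
  have all': "x \<rightarrow>\<^sup>*\<^bsub>X\<^esub> x' \<and> y \<rightarrow>\<^sup>*\<^bsub>Y\<^esub> y'"
    if "x \<in> pverts X" "x' \<in> pverts X" "y \<in> pverts Y" "y' \<in> pverts Y" for x x' y y'
    using reach[OF all[of "(x, y)" "(x', y')"]] that by simp
  show "connected X" using ne all' by (auto simp: X.connected_iff_reachable)
  show "connected Y" using ne all' by (auto simp: Y.connected_iff_reachable)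
qed

section \<open>Exchanging the factors\<close>

lemma dominating_set_swap:
  assumes "pair_graph X" "pair_graph Y" "dominating_set (cartesian_product X Y) S"
  shows "dominating_set (cartesian_product Y X) (prod.swap ` S)"
proof -
  interpret P: pair_graph "cartesian_product X Y"
    by (rule pair_graph_cartesian_product) fact+
  interpret Q: pair_graph "cartesian_product Y X"
    by (rule pair_graph_cartesian_product) fact+
  show ?thesis
    using assms(3) unfolding P.dominating_set_iff Q.dominating_set_iff
    by (force simp: parcs_cartesian_product)
qed

lemma minimal_dominating_set_swap:
  assumes "pair_graph X" "pair_graph Y" "minimal_dominating_set (cartesian_product X Y) S"
  shows "minimal_dominating_set (cartesian_product Y X) (prod.swap ` S)"
proof -
  have "\<not> dominating_set (cartesian_product Y X) (prod.swap ` S - {x})" if "x \<in> prod.swap ` S" for x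
  proof
    assume "dominating_set (cartesian_product Y X) (prod.swap ` S - {x})"
    then have "dominating_set (cartesian_product X Y) (prod.swap ` (prod.swap ` S - {x}))"
      by (rule dominating_set_swap[OF assms(2,1)])
    moreover have "prod.swap ` (prod.swap ` S - {x}) = S - {prod.swap x}"
      by (simp add: image_set_diff image_image)
    moreover have "prod.swap x \<in> S" using that by auto
    ultimately show False using assms(3) by (simp add: minimal_dominating_set_def)
  qed
  then show ?thesis
    using assms dominating_set_swap by (auto simp: minimal_dominating_set_def)
qed

text \<open>Coordinate exchange is a bijection preserving minimal dominating sets and cardinality.
  It allows the largest closed neighborhood to be placed in the first factor.\<close>

lemma well_dominated_swap:
  assumes "pair_graph X" "pair_graph Y" "well_dominated (cartesian_product X Y)"
  shows "well_dominated (cartesian_product Y X)"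
proof -
  let ?P = "with_proj (cartesian_product X Y)" and ?Q = "with_proj (cartesian_product Y X)"
  have card_swap: "card (prod.swap ` S) = card S" for S :: "('x \<times> 'y) set"
    by (rule card_image) simp
  have ex: "\<exists>S. dominating_set ?P S \<and> card S = k" if "dominating_set ?Q S" "card S = k" for S k
    using dominating_set_swap[OF assms(2,1) that(1)] that(2) card_swap by blast
  have ex': "\<exists>S. dominating_set ?Q S \<and> card S = k" if "dominating_set ?P S" "card S = k" for S k
    using dominating_set_swap[OF assms(1,2) that(1)] that(2) card_swap by blast
  have "domination_number ?P = domination_number ?Q"
    unfolding domination_number_def by (intro arg_cong[of _ _ Least] ext iffI) (use ex ex' in blast)+
  then show ?thesis
    using assms(3) minimal_dominating_set_swap[OF assms(2,1)] card_swap
    unfolding well_dominated_def by metis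
qed

section \<open>Large independent sets\<close>

text \<open>Vertices are added one at a time: the neighbors already colored number fewer than
  \<open>j\<close>, so some color is free.\<close>

lemma greedy_coloring:
  assumes "finite W" "sym A" "irrefl A"
    and "\<And>w. w \<in> W \<Longrightarrow> card {u \<in> W. (w, u) \<in> A} < j"
  obtains c :: "'a \<Rightarrow> nat" where "c \<in> W \<rightarrow> {..<j}"
    "\<And>u w. u \<in> W \<Longrightarrow> w \<in> W \<Longrightarrow> (u, w) \<in> A \<Longrightarrow> c u \<noteq> c w"
proof -
  have "\<exists>c. c \<in> W \<rightarrow> {..<j} \<and> (\<forall>u \<in> W. \<forall>w \<in> W. (u, w) \<in> A \<longrightarrow> c u \<noteq> c w)"
    using assms(1,4)
  proof (induction W rule: finite_induct)
    case empty
    then show ?case by simp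
  next
    case (insert x W)
    have "card {u \<in> W. (w, u) \<in> A} < j" if "w \<in> W" for w
      using insert.prems[of w] that insert.hyps(1)
        card_mono[of "{u \<in> insert x W. (w, u) \<in> A}" "{u \<in> W. (w, u) \<in> A}"]
      by force
    then obtain c where c: "c \<in> W \<rightarrow> {..<j}"
      "\<And>u w. u \<in> W \<Longrightarrow> w \<in> W \<Longrightarrow> (u, w) \<in> A \<Longrightarrow> c u \<noteq> c w"
      using insert.IH by blast
    let ?B = "{u \<in> W. (x, u) \<in> A}"
    have "card (c ` ?B) \<le> card ?B" using insert.hyps(1) by (intro card_image_le) auto
    also have "\<dots> \<le> card {u \<in> insert x W. (x, u) \<in> A}"
      using insert.hyps(1) by (intro card_mono) auto
    also have "\<dots> < card {..<j}" using insert.prems[of x] by simp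
    finally have less: "card (c ` ?B) < card {..<j}" .
    have "finite (c ` ?B)" using insert.hyps(1) by simp
    then have "\<not> {..<j} \<subseteq> c ` ?B" using less card_mono leD by blast
    then obtain i where i: "i < j" "i \<notin> c ` ?B" by auto
    have "c(x := i) \<in> insert x W \<rightarrow> {..<j}" using c(1) i by auto
    moreover have "(c(x := i)) u \<noteq> (c(x := i)) w"
      if "u \<in> insert x W" "w \<in> insert x W" "(u, w) \<in> A" for u w
      using that c(2) i assms(2,3) insert.hyps(2)
      by (auto simp: irrefl_def dest: symD)
    ultimately show ?case by blast
  qed
  with that show thesis by blast
qed

text \<open>
  The closed neighborhoods of a maximal independent set cover all vertices; if the set contains both
  ends of an induced path on three vertices, then two of these neighborhoods overlap.
\<close>
lemma (in pair_graph) large_independent_set_with_coloring: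
  assumes path: "(a, d) \<in> parcs G" "(d, c) \<in> parcs G" "(a, c) \<notin> parcs G" "a \<noteq> c"
    and deg: "\<And>v. v \<in> pverts G \<Longrightarrow> card (closed_neighborhood G {v}) \<le> Suc j"
  obtains I and f :: "'a \<Rightarrow> nat" where "independent_vertices G I"
    "card (pverts G) < Suc j * card I"
    "f \<in> pverts G - I \<rightarrow> {..<j}"
    "\<And>u w. u \<in> pverts G - I \<Longrightarrow> w \<in> pverts G - I \<Longrightarrow> (u, w) \<in> parcs G \<Longrightarrow> f u \<noteq> f w"
proof -
  let ?V = "pverts G" and ?N = "\<lambda>v. closed_neighborhood G {v}"
  have "independent_vertices G {a, c}"
    using path arcs_symmetric no_loops' wellformed' by (auto simp: independent_vertices_def)
  then obtain I where I: "{a, c} \<subseteq> I" "independent_vertices G I" "minimal_dominating_set G I"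
    by (rule independent_extends_to_minimal_dominating)
  have sub: "I \<subseteq> ?V" using I(2) by (simp add: independent_vertices_def)
  then have finI: "finite I" using pair_finite_verts finite_subset by blast
  have dom: "\<And>v. v \<in> ?V \<Longrightarrow> v \<in> I \<or> (\<exists>u \<in> I. (u, v) \<in> parcs G)"
    using I(3) by (simp add: minimal_dominating_set_def dominating_set_iff)
  have finN: "finite (?N v)" if "v \<in> ?V" for v
    by (rule finite_subset[OF _ pair_finite_verts])
      (use that in \<open>auto simp: closed_neighborhood_def\<close>)
  \<comment> \<open>The middle vertex \<open>d\<close> is covered by the neighborhood of
    \<open>a\<close> already; deleting it from that of \<open>c\<close> keeps the cover and makes
    the count strict.\<close>
  let ?M = "\<lambda>v. if v = c then ?N v - {d} else ?N v"
  have "?V \<subseteq> (\<Union>v\<in>I. ?M v)"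
  proof
    fix v assume v: "v \<in> ?V"
    show "v \<in> (\<Union>v\<in>I. ?M v)"
    proof (cases "v = d")
      case True
      then have "v \<in> ?M a" using path v by (auto simp: closed_neighborhood_def)
      then show ?thesis using I(1) by blast
    next
      case False
      obtain u where u: "u \<in> I" "v \<in> ?N u"
        using dom[OF v] v by (fastforce simp: closed_neighborhood_def)
      then have "v \<in> ?M u" using False by auto
      then show ?thesis using u(1) by blast
    qed
  qed
  moreover have "finite (?M v)" if "v \<in> I" for v
    using finN[of v] that sub by (cases "v = c") auto
  then have "finite (\<Union>v\<in>I. ?M v)" using finI by blast
  ultimately have "card ?V \<le> card (\<Union>v\<in>I. ?M v)" by (rule card_mono[rotated])
  also have "\<dots> \<le> (\<Sum>v\<in>I. card (?M v))" by (rule card_UN_le[OF finI])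
  also have "\<dots> < (\<Sum>v\<in>I. Suc j)"
  proof (rule sum_strict_mono_ex1[OF finI])
    show "\<forall>v\<in>I. card (?M v) \<le> Suc j"
      using deg sub finN by (auto intro: le_trans[OF card_Diff1_le])
    have "d \<in> ?N c" "c \<in> ?V"
      using path wellformed' arcs_symmetric by (auto simp: closed_neighborhood_def)
    then have "card (?M c) < card (?N c)" using finN[of c] by (simp only: if_True simp_thms card_Diff1_less)
    then have "card (?M c) < Suc j" using deg[OF \<open>c \<in> ?V\<close>] by linarith
    then show "\<exists>v\<in>I. card (?M v) < Suc j" using I(1) by blast
  qed
  finally have card: "card ?V < Suc j * card I" by (simp add: mult.commute)
  \<comment> \<open>The at most \<open>Suc j\<close> elements of the closed neighborhood include
    \<open>w\<close> itself and a neighbor in \<open>I\<close>, which leaves at most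
    \<open>j - 1\<close>.\<close>
  have deg_outside: "card {u \<in> ?V - I. (w, u) \<in> parcs G} < j" if w: "w \<in> ?V - I" for w
  proof -
    obtain i where "i \<in> I" "(i, w) \<in> parcs G" using dom[of w] w by blast
    then have i: "i \<in> I" "(w, i) \<in> parcs G" by (auto intro: arcs_symmetric)
    have "insert w (insert i {u \<in> ?V - I. (w, u) \<in> parcs G}) \<subseteq> ?N w"
      using i w sub by (auto simp: closed_neighborhood_def)
    then have "card (insert w (insert i {u \<in> ?V - I. (w, u) \<in> parcs G})) \<le> card (?N w)"
      using finN w by (intro card_mono) auto
    moreover have "card (insert w (insert i {u \<in> ?V - I. (w, u) \<in> parcs G})) =
        Suc (Suc (card {u \<in> ?V - I. (w, u) \<in> parcs G}))"
      using i w no_loops' pair_finite_verts by (subst card_insert_disjoint; force)+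
    ultimately show ?thesis using deg[of w] w by auto
  qed
  have "finite (?V - I)" "sym (parcs G)" "irrefl (parcs G)"
    using arcs_symmetric no_loops' pair_finite_verts by (auto simp: sym_def irrefl_def)
  then show thesis
    by (rule greedy_coloring[OF _ _ _ deg_outside]) (assumption, rule that[OF I(2) card], blast+)
qed

text \<open>
  Off \<open>I \<times> J\<close>, the sets on which the difference of the two colorings is a given residue modulo \<open>j\<close>
  are independent and partition \<open>(V(G) - I) \<times> (V(H) - J)\<close>; the largest of them is added to \<open>I \<times> J\<close>.
\<close>
lemma cartesian_product_independent_from_colorings:
  fixes f :: "'a \<Rightarrow> nat" and g :: "'b \<Rightarrow> nat"
  assumes "pair_graph G" "pair_graph H" "0 < j"
    and I: "independent_vertices G I" "f \<in> pverts G - I \<rightarrow> {..<j}"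
    and f: "\<And>u w. u \<in> pverts G - I \<Longrightarrow> w \<in> pverts G - I \<Longrightarrow> (u, w) \<in> parcs G \<Longrightarrow> f u \<noteq> f w"
    and J: "independent_vertices H J" "g \<in> pverts H - J \<rightarrow> {..<j}"
    and g: "\<And>u w. u \<in> pverts H - J \<Longrightarrow> w \<in> pverts H - J \<Longrightarrow> (u, w) \<in> parcs H \<Longrightarrow> g u \<noteq> g w"
  obtains S where "independent_vertices (cartesian_product G H) S"
    "card (pverts G - I) * card (pverts H - J) + j * (card I * card J) \<le> j * card S"
proof -
  interpret G: pair_graph G by fact
  interpret H: pair_graph H by fact
  let ?W = "(pverts G - I) \<times> (pverts H - J)"
  \<comment> \<open>With one coordinate fixed, the residue determines the color of the other.
    Integers avoid truncated subtraction.\<close>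
  let ?h = "\<lambda>(x, y). (int (g y) - int (f x)) mod int j"
  have IJ: "I \<subseteq> pverts G" "J \<subseteq> pverts H"
    using I(1) J(1) by (auto simp: independent_vertices_def)
  have fin: "finite I" "finite J" "finite ?W"
    using IJ G.pair_finite_verts H.pair_finite_verts by (auto intro: finite_subset)
  have "?h \<in> ?W \<rightarrow> {0..<int j}" using assms(3) by auto
  then obtain s where "card ?W \<le> card (?h -` {s} \<inter> ?W) * card {0..<int j}"
    using pigeonhole_card[of ?h ?W "{0..<int j}"] fin(3) assms(3) by auto
  then have s: "card (pverts G - I) * card (pverts H - J) \<le> j * card (?h -` {s} \<inter> ?W)"
    by (simp add: card_cartesian_product mult.commute)
  let ?S = "I \<times> J \<union> (?h -` {s} \<inter> ?W)"
  have "card ?S = card I * card J + card (?h -` {s} \<inter> ?W)"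
    using fin by (subst card_Un_disjoint) (auto simp: card_cartesian_product)
  then have "card (pverts G - I) * card (pverts H - J) + j * (card I * card J) \<le> j * card ?S"
    using s by (simp add: algebra_simps)
  moreover have "(p, q) \<notin> parcs (cartesian_product G H)" if pq: "p \<in> ?S" "q \<in> ?S" for p q
  proof
    obtain x y x' y' where eq: "p = (x, y)" "q = (x', y')" by (cases p; cases q)
    assume "(p, q) \<in> parcs (cartesian_product G H)"
    then consider "x = x'" "(y, y') \<in> parcs H" | "y = y'" "(x, x') \<in> parcs G"
      by (auto simp: eq parcs_cartesian_product)
    then show False
    proof cases
      case 1
      \<comment> \<open>Sharing \<open>x\<close>, both points lie in the same part of
        \<open>?S\<close>, and this is not \<open>I \<times> J\<close> because \<open>J\<close> is
        independent.\<close>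
      then have "(x, y) \<in> ?h -` {s} \<inter> ?W" "(x, y') \<in> ?h -` {s} \<inter> ?W"
        using pq eq J(1) by (auto simp: independent_vertices_def)
      then have y: "y \<in> pverts H - J" "y' \<in> pverts H - J"
        and "(int (g y) - int (f x)) mod int j = (int (g y') - int (f x)) mod int j"
        by auto
      then have "int (g y) mod int j = int (g y') mod int j"
        by (metis mod_add_cong diff_add_cancel)
      \<comment> \<open>Colors below \<open>j\<close> are their own residues, so the adjacent
        \<open>y\<close> and \<open>y'\<close> would have equal colors.\<close>
      moreover have "g y < j" "g y' < j" using y J(2) by auto
      ultimately show False using g[OF y 1(2)] by simp
    next
      case 2
      then have "(x, y) \<in> ?h -` {s} \<inter> ?W" "(x', y) \<in> ?h -` {s} \<inter> ?W"
        using pq eq I(1) by (auto simp: independent_vertices_def)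
      then have x: "x \<in> pverts G - I" "x' \<in> pverts G - I"
        and h: "(int (g y) - int (f x)) mod int j = (int (g y) - int (f x')) mod int j"
        by auto
      have "int (f x) mod int j = int (f x') mod int j"
        using mod_diff_cong[OF refl[of "int (g y) mod int j"] h] by simp
      moreover have "f x < j" "f x' < j" using x I(2) by auto
      ultimately show False using f[OF x 2(2)] by simp
    qed
  qed
  moreover have "?S \<subseteq> pverts G \<times> pverts H" using IJ by auto
  ultimately show thesis
    using that[of ?S] unfolding independent_vertices_def with_proj_simps pverts_cartesian_product
    by blast
qed

text \<open>
  Both factors have independent sets of relative density above \<open>1 / (j + 1)\<close>; pairing the dense
  classes with each other is what makes the density in the product exceed \<open>1 / (j + 1)\<close> as well.
\<close>
lemma product_density:
  fixes n m p q j t :: nat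
  assumes "n < Suc j * p" "m < Suc j * q" "p \<le> n" "q \<le> m"
    and "(n - p) * (m - q) + j * (p * q) \<le> j * t"
  shows "n * m < Suc j * t"
proof (cases "j = 0")
  case True
  \<comment> \<open>Here the hypotheses \<open>n < p\<close> and \<open>p \<le> n\<close> contradict
    each other.\<close>
  then show ?thesis using assms by simp
next
  case False
  define n' m' p' q' j' t' where "n' = int n" "m' = int m" "p' = int p" "q' = int q"
    "j' = int j" "t' = int t"
  note defs = this
  have "int ((n - p) * (m - q) + j * (p * q)) \<le> int (j * t)" using assms(5) by linarith
  then have t: "(n' - p') * (m' - q') + j' * (p' * q') \<le> j' * t'"
    using assms(3,4) by (simp add: defs of_nat_diff)
  have "int n < int (Suc j * p)" "int m < int (Suc j * q)" using assms(1,2) by linarith+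
  then have "0 < (j' + 1) * p' - n'" "0 < (j' + 1) * q' - m'"
    by (simp_all add: defs algebra_simps)
  \<comment> \<open>Both factors measure the excess over density \<open>1 / (j + 1)\<close>;
    expanding their product brings out the left side of the bound \<open>t\<close>, and a positive
    factor \<open>j'\<close> then cancels.\<close>
  then have "0 < ((j' + 1) * p' - n') * ((j' + 1) * q' - m')" by (rule mult_pos_pos)
  also have "\<dots> = (j' + 1) * ((n' - p') * (m' - q') + j' * (p' * q')) - j' * (n' * m')"
    by (simp add: algebra_simps)
  also have "\<dots> \<le> (j' + 1) * (j' * t') - j' * (n' * m')"
    using t by (intro diff_right_mono mult_left_mono) (simp_all add: defs)
  also have "\<dots> = j' * ((j' + 1) * t' - n' * m')" by (simp add: algebra_simps)
  finally have "0 < (j' + 1) * t' - n' * m'"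
    using False by (simp add: zero_less_mult_iff defs)
  then have "int (n * m) < int (Suc j * t)" by (simp add: defs algebra_simps)
  then show ?thesis by linarith
qed

section \<open>Small dominating sets\<close>

text \<open>
  Bollobas and Cockayne: among the minimum dominating sets, one inducing the most edges has the
  required property, since a vertex without external private neighbor is isolated in the set and
  can be exchanged for any of its neighbors.
\<close>
lemma (in pair_graph) dominating_set_with_private_neighbors:
  assumes "\<And>v. v \<in> pverts G \<Longrightarrow> \<exists>u. (v, u) \<in> parcs G"
  obtains E where "dominating_set G E"
    "\<And>e. e \<in> E \<Longrightarrow> \<exists>f \<in> pverts G - E. \<forall>u \<in> E. (u, f) \<in> parcs G \<longrightarrow> u = e"
proof -
  let ?P = "\<lambda>E. dominating_set G E \<and> card E = domination_number G"
  let ?m = "\<lambda>E. card (parcs G \<inter> E \<times> E)"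
  have "\<exists>E. ?P E"
    unfolding domination_number_def by (rule LeastI_ex) (use pverts_dominating in blast)
  then obtain E0 where "?P E0" by blast
  moreover have "?m E < Suc (card (parcs G))" for E
    by (simp add: less_Suc_eq_le card_mono pair_finite_arcs)
  ultimately obtain E where E: "?P E" and max: "\<And>E'. ?P E' \<Longrightarrow> ?m E' \<le> ?m E"
    using ex_has_greatest_nat[of ?P E0 ?m "Suc (card (parcs G))"] by blast
  have min: "card E \<le> card D" if "dominating_set G D" for D
    using E that unfolding domination_number_def by (metis (mono_tags, lifting) Least_le)
  have sub: "E \<subseteq> pverts G" using E by (simp add: dominating_set_iff)
  then have fin: "finite E" by (rule finite_subset[OF _ pair_finite_verts])
  have "\<exists>f \<in> pverts G - E. \<forall>u \<in> E. (u, f) \<in> parcs G \<longrightarrow> u = e" if e: "e \<in> E" for e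
  proof (rule ccontr)
    assume "\<not> ?thesis"
    then have other: "\<And>f. f \<in> pverts G \<Longrightarrow> f \<notin> E \<Longrightarrow> \<exists>u \<in> E - {e}. (u, f) \<in> parcs G"
      by blast
    have "card (E - {e}) < card E" using fin e by (rule card_Diff1_less)
    then have "\<not> dominating_set G (E - {e})" using min by fastforce
    \<comment> \<open>A neighbor of \<open>e\<close> inside \<open>E\<close> would make
      \<open>E - {e}\<close> dominating, against the minimum size of \<open>E\<close>.\<close>
    have isolated: "(u, e) \<notin> parcs G" if u: "u \<in> E" for u
    proof
      assume ue: "(u, e) \<in> parcs G"
      then have "u \<in> E - {e}" using u no_loops' by blast
      then have "dominating_set G (E - {e})"
        using ue other sub by (auto simp: dominating_set_iff)
      then show False using \<open>\<not> dominating_set G (E - {e})\<close> by contradiction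
    qed
    obtain w where w: "(e, w) \<in> parcs G" using assms e sub by blast
    then have we: "(w, e) \<in> parcs G" by (rule arcs_symmetric)
    then have "w \<in> pverts G" "w \<notin> E"
      using isolated wellformed'(1) by blast+
    let ?E = "insert w (E - {e})"
    have "dominating_set G ?E"
      unfolding dominating_set_iff
    proof (intro conjI ballI)
      show "?E \<subseteq> pverts G" using sub \<open>w \<in> pverts G\<close> by blast
      show "v \<in> ?E \<or> (\<exists>u \<in> ?E. (u, v) \<in> parcs G)" if "v \<in> pverts G" for v
        using other[OF that] we by (cases "v = e"; cases "v \<in> E") blast+
    qed
    moreover have "card ?E = card E"
      using card.remove[OF fin e] fin \<open>w \<notin> E\<close> by simp
    ultimately have "?m ?E \<le> ?m E" using E by (intro max) simp
    moreover obtain u where u: "u \<in> E - {e}" "(u, w) \<in> parcs G"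
      using other \<open>w \<in> pverts G\<close> \<open>w \<notin> E\<close> by blast
    \<comment> \<open>The exchange loses no arc, \<open>e\<close> being isolated in
      \<open>E\<close>, and gains the one from the other dominator \<open>u\<close> of
      \<open>w\<close>.\<close>
    have "parcs G \<inter> E \<times> E \<subset> parcs G \<inter> ?E \<times> ?E"
    proof
      have "(e, x) \<notin> parcs G" if "x \<in> E" for x
        using isolated[OF that] arcs_symmetric[of e x] by blast
      with isolated show "parcs G \<inter> E \<times> E \<subseteq> parcs G \<inter> ?E \<times> ?E" by auto
      have "(u, w) \<in> parcs G \<inter> ?E \<times> ?E" using u by blast
      then show "parcs G \<inter> E \<times> E \<noteq> parcs G \<inter> ?E \<times> ?E" using \<open>w \<notin> E\<close> by blast
    qed
    then have "?m E < ?m ?E" by (intro psubset_card_mono) (simp_all add: pair_finite_arcs)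
    ultimately show False by simp
  qed
  with E that show thesis by blast
qed

text \<open>
  \<open>V(G) \<times> E\<close> is a minimal dominating set, \<open>{v} \<times> V(H) \<union> (V(G) - N[v]) \<times> E\<close> a dominating one.
\<close>
lemma closed_neighborhood_mult_card_le:
  assumes "pair_graph G" "pair_graph H" "well_dominated (cartesian_product G H)"
    and E: "dominating_set H E"
      "\<And>e. e \<in> E \<Longrightarrow> \<exists>f \<in> pverts H - E. \<forall>u \<in> E. (u, f) \<in> parcs H \<longrightarrow> u = e"
    and v: "v \<in> pverts G"
  shows "minimal_dominating_set (cartesian_product G H) (pverts G \<times> E)"
    and "card (closed_neighborhood G {v}) * card E \<le> card (pverts H)"
proof -
  interpret G: pair_graph G by fact
  interpret H: pair_graph H by fact
  interpret P: pair_graph "cartesian_product G H"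
    by (rule pair_graph_cartesian_product) fact+
  let ?M = "pverts G \<times> E" and ?N = "closed_neighborhood G {v}"
  let ?D = "{v} \<times> pverts H \<union> (pverts G - ?N) \<times> E"
  have sub: "E \<subseteq> pverts H" "?N \<subseteq> pverts G"
    and dom: "\<And>y. y \<in> pverts H \<Longrightarrow> y \<in> E \<or> (\<exists>u \<in> E. (u, y) \<in> parcs H)"
    using E(1) v by (auto simp: H.dominating_set_iff closed_neighborhood_def)
  then have fin: "finite E" "finite ?N"
    using G.pair_finite_verts H.pair_finite_verts finite_subset by blast+
  have "dominating_set (cartesian_product G H) ?M"
    using sub dom by (fastforce simp: P.dominating_set_iff parcs_cartesian_product)
  \<comment> \<open>If \<open>f\<close> is private to \<open>e\<close>, then \<open>(x, f)\<close>
    is private to \<open>(x, e)\<close>: its neighbors with second coordinate \<open>f\<close> are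
    not in \<open>?M\<close>, as \<open>f \<notin> E\<close>.\<close>
  moreover have "\<not> dominating_set (cartesian_product G H) (?M - {p})" if pM: "p \<in> ?M" for p
  proof -
    obtain x e where p: "p = (x, e)" "x \<in> pverts G" "e \<in> E" using pM by auto
    then obtain f where "f \<in> pverts H - E" "\<And>u. u \<in> E \<Longrightarrow> (u, f) \<in> parcs H \<Longrightarrow> u = e"
      using E(2) by blast
    then have f: "(x, f) \<in> pverts G \<times> pverts H" "(x, f) \<notin> ?M - {p}"
      and adj: "\<And>x' u. u \<in> E \<Longrightarrow> ((x', u), (x, f)) \<in> parcs (cartesian_product G H) \<Longrightarrow>
        (x', u) = p"
      using p by (auto simp: parcs_cartesian_product)
    show ?thesis
    proof
      assume "dominating_set (cartesian_product G H) (?M - {p})"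
      then obtain q where "q \<in> ?M - {p}" "(q, (x, f)) \<in> parcs (cartesian_product G H)"
        unfolding P.dominating_set_iff pverts_cartesian_product using f by meson
      then show False using adj[of "snd q" "fst q"] by auto
    qed
  qed
  ultimately show M: "minimal_dominating_set (cartesian_product G H) ?M"
    by (simp add: minimal_dominating_set_def)
  \<comment> \<open>Fibers over \<open>?N\<close> are dominated from the full fiber over
    \<open>v\<close>, each other fiber by its own copy of \<open>E\<close>.\<close>
  have "dominating_set (cartesian_product G H) ?D"
    unfolding P.dominating_set_iff
  proof (intro conjI ballI)
    show "?D \<subseteq> pverts (cartesian_product G H)" using v sub by auto
  next
    fix p assume "p \<in> pverts (cartesian_product G H)"
    then obtain x y where p: "p = (x, y)" "x \<in> pverts G" "y \<in> pverts H" by auto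
    show "p \<in> ?D \<or> (\<exists>q \<in> ?D. (q, p) \<in> parcs (cartesian_product G H))"
    proof (cases "x \<in> ?N")
      case True
      then have "x = v \<or> (v, x) \<in> parcs G" using G.closed_neighborhood_singleton[OF v] by blast
      then show ?thesis
      proof
        assume "(v, x) \<in> parcs G"
        then have "((v, y), p) \<in> parcs (cartesian_product G H)"
          using p by (simp add: parcs_cartesian_product)
        then show ?thesis using p by blast
      qed (use p in blast)
    next
      case False
      consider "y \<in> E" | u where "u \<in> E" "(u, y) \<in> parcs H" using dom p by blast
      then show ?thesis
      proof cases
        case 1
        then show ?thesis using False p by blast
      next
        case 2
        then have "((x, u), p) \<in> parcs (cartesian_product G H)"
          using p by (simp add: parcs_cartesian_product)
        then show ?thesis using 2 False p by blast
      qed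
    qed
  qed
  then have "card ?M \<le> card ?D" by (rule minimal_dominating_card_le[OF assms(3) M])
  also have "\<dots> \<le> card ({v} \<times> pverts H) + card ((pverts G - ?N) \<times> E)" by (rule card_Un_le)
  also have "\<dots> = card (pverts H) + (card (pverts G) - card ?N) * card E"
    using fin sub by (simp add: card_cartesian_product card_Diff_subset)
  finally have "card (pverts G) * card E \<le> card (pverts H) + (card (pverts G) - card ?N) * card E"
    by (simp add: card_cartesian_product)
  \<comment> \<open>This keeps the natural-number subtraction from truncating.\<close>
  moreover have "card ?N * card E \<le> card (pverts G) * card E"
    by (intro mult_le_mono1 card_mono G.pair_finite_verts sub)
  ultimately show "card ?N * card E \<le> card (pverts H)"
    unfolding diff_mult_distrib by linarith
qed

section \<open>The factors of a well-dominated product\<close>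

text \<open>The bound on neighborhoods in both factors gives the dense independent sets; its being
  attained at \<open>v\<close> in \<open>G\<close> gives the matching upper estimate.\<close>

lemma well_dominated_product_complete_factor:
  assumes "pair_graph G" "pair_graph H"
    and wd: "well_dominated (cartesian_product G H)"
    and conn: "connected G" "connected H"
    and v: "v \<in> pverts G"
    and degG: "\<And>u. u \<in> pverts G \<Longrightarrow>
      card (closed_neighborhood G {u}) \<le> card (closed_neighborhood G {v})"
    and degH: "\<And>u. u \<in> pverts H \<Longrightarrow>
      card (closed_neighborhood H {u}) \<le> card (closed_neighborhood G {v})"
  shows "complete_graph G \<or> complete_graph H"
proof (rule ccontr)
  assume "\<not> ?thesis"
  then have nc: "\<not> complete_graph G" "\<not> complete_graph H" by auto
  interpret G: pair_graph G by fact
  interpret H: pair_graph H by fact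
  interpret P: pair_graph "cartesian_product G H"
    by (rule pair_graph_cartesian_product) fact+
  let ?k = "card (closed_neighborhood G {v})"
  obtain a d c where G_path:
    "(a, d) \<in> parcs G" "(d, c) \<in> parcs G" "(a, c) \<notin> parcs G" "a \<noteq> c"
    using G.connected_noncomplete_induced_path[OF conn(1) nc(1)] by blast
  obtain x y z where H_path:
    "(x, y) \<in> parcs H" "(y, z) \<in> parcs H" "(x, z) \<notin> parcs H" "x \<noteq> z"
    using H.connected_noncomplete_induced_path[OF conn(2) nc(2)] by blast
  \<comment> \<open>Two elements in one closed neighborhood give \<open>0 < j\<close>, as residues
    modulo \<open>j\<close> require.\<close>
  have "{d, c} \<subseteq> closed_neighborhood G {d}" "d \<noteq> c" "d \<in> pverts G"
    using G_path G.wellformed' G.no_loops' by (auto simp: closed_neighborhood_def)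
  moreover have "finite (closed_neighborhood G {d})"
    by (rule finite_subset[OF _ G.pair_finite_verts])
      (use \<open>d \<in> pverts G\<close> in \<open>auto simp: closed_neighborhood_def\<close>)
  ultimately have "2 \<le> ?k"
    using card_mono[of "closed_neighborhood G {d}" "{d, c}"] degG[of d] by simp
  then obtain j where j: "?k = Suc j" "0 < j" by (cases ?k) auto
  obtain I and f :: "'a \<Rightarrow> nat" where I: "independent_vertices G I"
      "card (pverts G) < Suc j * card I" "f \<in> pverts G - I \<rightarrow> {..<j}"
    and f: "\<And>u w. u \<in> pverts G - I \<Longrightarrow> w \<in> pverts G - I \<Longrightarrow> (u, w) \<in> parcs G \<Longrightarrow> f u \<noteq> f w"
    using G.large_independent_set_with_coloring[OF G_path degG[unfolded j(1)]] by blast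
  obtain J and g :: "'b \<Rightarrow> nat" where J: "independent_vertices H J"
      "card (pverts H) < Suc j * card J" "g \<in> pverts H - J \<rightarrow> {..<j}"
    and g: "\<And>u w. u \<in> pverts H - J \<Longrightarrow> w \<in> pverts H - J \<Longrightarrow> (u, w) \<in> parcs H \<Longrightarrow> g u \<noteq> g w"
    using H.large_independent_set_with_coloring[OF H_path degH[unfolded j(1)]] by blast
  obtain S where S: "independent_vertices (cartesian_product G H) S"
    "card (pverts G - I) * card (pverts H - J) + j * (card I * card J) \<le> j * card S"
    by (rule cartesian_product_independent_from_colorings
        [OF assms(1,2) j(2) I(1,3) f J(1,3) g])
  have sub: "I \<subseteq> pverts G" "J \<subseteq> pverts H"
    using I(1) J(1) by (auto simp: independent_vertices_def)
  then have fin: "finite I" "finite J"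
    using G.pair_finite_verts H.pair_finite_verts finite_subset by blast+
  have "card (pverts G) * card (pverts H) < Suc j * card S"
  proof (rule product_density[OF I(2) J(2)])
    show "card I \<le> card (pverts G)" "card J \<le> card (pverts H)"
      using sub G.pair_finite_verts H.pair_finite_verts by (simp_all add: card_mono)
    show "(card (pverts G) - card I) * (card (pverts H) - card J) + j * (card I * card J)
        \<le> j * card S"
      using S(2) sub fin by (simp add: card_Diff_subset)
  qed
  \<comment> \<open>Connectedness leads from \<open>w\<close> towards \<open>x\<close>; for
    \<open>w = x\<close> the neighbor is \<open>y\<close>.\<close>
  moreover have "\<exists>u. (w, u) \<in> parcs H" if "w \<in> pverts H" for w
    using H.connected_has_neighbor[OF conn(2) that H.wellformed'(1)[OF H_path(1)]] H_path(1)
    by blast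
  then obtain E where E: "dominating_set H E"
    "\<And>e. e \<in> E \<Longrightarrow> \<exists>f \<in> pverts H - E. \<forall>u \<in> E. (u, f) \<in> parcs H \<longrightarrow> u = e"
    using H.dominating_set_with_private_neighbors by blast
  note M = closed_neighborhood_mult_card_le[OF assms(1,2) wd E v]
  \<comment> \<open>Multiplied by \<open>Suc j\<close>, this bounds \<open>Suc j * card S\<close> by
    the order of the product, which the density estimate exceeds.\<close>
  have "card S \<le> card (pverts G \<times> E)"
    using P.independent_card_le[OF wd S(1)] M(1) by (simp add: minimal_dominating_set_def)
  then have "Suc j * card S \<le> card (pverts G) * (Suc j * card E)"
    using mult_le_mono2[of "card S" "card (pverts G) * card E" "Suc j"]
    by (simp only: card_cartesian_product mult.left_commute)
  also have "\<dots> \<le> card (pverts G) * card (pverts H)"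
    using M(2) j(1) by (intro mult_le_mono2) simp
  ultimately show False by simp
qed

lemma finite_obtains_max:
  fixes f :: "'a \<Rightarrow> nat"
  assumes "finite A" "A \<noteq> {}"
  obtains x where "x \<in> A" "\<And>y. y \<in> A \<Longrightarrow> f y \<le> f x"
proof -
  have "Max (f ` A) \<in> f ` A" using assms by (intro Max_in) auto
  then obtain x where "x \<in> A" "f x = Max (f ` A)" by auto
  with assms(1) that show thesis by (metis Max_ge finite_imageI imageI)
qed

theorem theorem4:
  fixes G :: "'a pair_pre_digraph" and H :: "'b pair_pre_digraph"
  assumes "pair_graph G" and "pverts G \<noteq> {}"
    and "pair_graph H" and "pverts H \<noteq> {}"
    and "connected (with_proj (cartesian_product G H))"
    and "well_dominated (with_proj (cartesian_product G H))"
  shows "complete_graph (with_proj G) \<or> complete_graph (with_proj H)"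
proof -
  let ?N = "\<lambda>u. card (closed_neighborhood G {u})" and ?N' = "\<lambda>u. card (closed_neighborhood H {u})"
  have conn: "connected G" "connected H"
    using connected_cartesian_product assms(1,3,5) by blast+
  have "finite (pverts G)" "finite (pverts H)"
    using assms(1,3) by (auto simp: pair_graph_def pair_digraph_def pair_fin_digraph.pair_finite_verts)
  then obtain v w where v: "v \<in> pverts G" "\<And>u. u \<in> pverts G \<Longrightarrow> ?N u \<le> ?N v"
    and w: "w \<in> pverts H" "\<And>u. u \<in> pverts H \<Longrightarrow> ?N' u \<le> ?N' w"
    using finite_obtains_max[of "pverts G" ?N] finite_obtains_max[of "pverts H" ?N'] assms(2,4)
    by metis
  show ?thesis
  \<comment> \<open>The factor with the larger maximum closed neighborhood plays the role of the
    first one.\<close>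
  proof (cases "?N' w \<le> ?N v")
    case True
    then show ?thesis
      using well_dominated_product_complete_factor[OF assms(1,3,6) conn v] w(2) le_trans by blast
  next
    case False
    then have "\<And>u. u \<in> pverts G \<Longrightarrow> ?N u \<le> ?N' w" using v(2) by fastforce
    then show ?thesis
      using well_dominated_product_complete_factor[OF assms(3,1)
          well_dominated_swap[OF assms(1,3,6)] conn(2,1) w] by blast
  qed
qed

end
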